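(* Let $k\in\{1,\dots,N\}$ and $s>0$. For every online learning algorithm for the prediction with expert advice problem with $N$ experts and $T$ rounds, there exists a sequence of loss vectors $\boldsymbol{l}_1,\dots,\boldsymbol{l}_T\in[-s,s]^N$ with $\|\boldsymbol{l}_t\|_0=k$ for all $t\in\{1,\dots,T\}$, such that $$\mathrm{Regret}_T\ge2s\sqrt{\frac{\lfloor\ln k\rfloor T}{8}}.$$
   Context: Prediction with expert advice: in each round $t=1,\dots,T$ the learner plays $\mathbf{p}_t\in\Delta_N=\{\mathbf{x}\in[0,1]^N:\sum_ix_i=1\}$, then the loss vector $\boldsymbol{l}_t\in\mathbb{R}^N$ is revealed and the learner suffers $\mathbf{p}_t\cdot\boldsymbol{l}_t$. An online learning algorithm is a rule choosing each $\mathbf{p}_t$ as a function of $\boldsymbol{l}_1,\dots,\boldsymbol{l}_{t-1}$. The regret is $\mathrm{Regret}_T=\sum_{t=1}^T\mathbf{p}_t\cdot\boldsymbol{l}_t-\min_{i\in\{1,\dots,N\}}\sum_{t=1}^T l_t(i)$. $\|\mathbf{x}\|_0$ denotes the number of nonzero coordinates of $\mathbf{x}$.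
   Formalization: The formal theorem additionally assumes ⌊ln k⌋ ≤ 2T; without a relation between k and T the claim fails, e.g. T=1, k=21, N=100 with uniform play has regret at most 1.21s, below the bound of about 1.2247s. *)

theory Defs
  imports "HOL-Analysis.Analysis"
begin

definition prob_simplex :: "(real^'n) set" where
  "prob_simplex = {x. (\<forall>i. x $ i \<in> {0..1}) \<and> (\<Sum>i\<in>UNIV. x $ i) = 1}"

definition zero_norm :: "real^'n \<Rightarrow> nat" where
  "zero_norm x = card {i. x $ i \<noteq> 0}"

(* A strategy maps the list of losses revealed so far to the next play. Over T rounds it is only
   ever consulted on histories of length less than T; its other values are irrelevant. *)
definition online_algorithm :: "nat \<Rightarrow> ((real^'n) list \<Rightarrow> real^'n) \<Rightarrow> bool" where
  "online_algorithm T A \<longleftrightarrow> (\<forall>h. length h < T \<longrightarrow> A h \<in> prob_simplex)"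

(* The loss vectors are l 1, l 2, ...; the history at round t is [l 1, ..., l (t - 1)]. *)
definition play :: "((real^'n) list \<Rightarrow> real^'n) \<Rightarrow> (nat \<Rightarrow> real^'n) \<Rightarrow> nat \<Rightarrow> real^'n" where
  "play A l t = A (map l [1..<t])"

definition regret :: "((real^'n) list \<Rightarrow> real^'n) \<Rightarrow> (nat \<Rightarrow> real^'n) \<Rightarrow> nat \<Rightarrow> real" where
  "regret A l T =
     (\<Sum>t = 1..T. play A l t \<bullet> l t) - Min (range (\<lambda>i. \<Sum>t = 1..T. l t $ i))"

(* The lower bound 2 s sqrt (floor (ln k) T / 8) needs floor (ln k) \<le> 2 T: below that horizon,
   playing uniformly beats it against every adversary with k nonzero losses per
   round once there are enough experts. *)
lemma uniform_play_beats_bound: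
  fixes s :: real and k T :: nat
  assumes "s > 0" and "T \<ge> 1"
    and short: "\<lfloor>ln (real k)\<rfloor> > 2 * int T"
    and many: "real k * real T
      < real CARD('n::finite) * (sqrt (of_int \<lfloor>ln (real k)\<rfloor> * real T / 2) - real T)"
  shows "\<exists>A :: (real^'n) list \<Rightarrow> real^'n. online_algorithm T A \<and>
    (\<forall>l. (\<forall>t\<in>{1..T}. (\<forall>i. l t $ i \<in> {-s..s}) \<and> zero_norm (l t) = k) \<longrightarrow>
       regret A l T < 2 * s * sqrt (of_int \<lfloor>ln (real k)\<rfloor> * real T / 8))"
proof -
  let ?N = "real CARD('n)" and ?m = "real_of_int \<lfloor>ln (real k)\<rfloor>"
  define A :: "(real^'n) list \<Rightarrow> real^'n" where "A = (\<lambda>h. \<chi> i. 1 / ?N)"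
  have N: "?N \<ge> 1" by (simp add: Suc_leI)
  have alg: "online_algorithm T A"
    using N by (simp add: online_algorithm_def prob_simplex_def A_def)
  have "regret A l T < 2 * s * sqrt (?m * T / 8)"
    if l: "\<forall>t\<in>{1..T}. (\<forall>i. l t $ i \<in> {-s..s}) \<and> zero_norm (l t) = k" for l
  proof -
    have round: "play A l t \<bullet> l t \<le> s * k / ?N" if "t \<in> {1..T}" for t
    proof -
      have "(\<Sum>i\<in>UNIV. l t $ i) = (\<Sum>i | l t $ i \<noteq> 0. l t $ i)"
        by (rule sum.mono_neutral_right) auto
      also have "\<dots> \<le> (\<Sum>i | l t $ i \<noteq> 0. s)"
        using l that by (intro sum_mono) auto
      also have "\<dots> = s * k" using l that by (simp add: zero_norm_def)
      finally have "(\<Sum>i\<in>UNIV. l t $ i) / ?N \<le> s * k / ?N"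
        using N by (intro divide_right_mono) auto
      then show ?thesis
        by (simp add: play_def A_def inner_vec_def sum_divide_distrib)
    qed
    have "(\<Sum>t = 1..T. play A l t \<bullet> l t) \<le> (\<Sum>t = 1..T. s * k / ?N)"
      using round by (rule sum_mono)
    then have 1: "(\<Sum>t = 1..T. play A l t \<bullet> l t) \<le> s * (k * T / ?N)"
      by (simp add: mult.commute mult.left_commute)
    have "Min (range (\<lambda>i. \<Sum>t = 1..T. l t $ i)) \<in> range (\<lambda>i. \<Sum>t = 1..T. l t $ i)"
      by (rule Min_in) auto
    then obtain i where i: "Min (range (\<lambda>i. \<Sum>t = 1..T. l t $ i)) = (\<Sum>t = 1..T. l t $ i)" by blast
    have "(\<Sum>t = 1..T. - s) \<le> (\<Sum>t = 1..T. l t $ i)"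
      using l by (intro sum_mono) auto
    then have 2: "Min (range (\<lambda>i. \<Sum>t = 1..T. l t $ i)) \<ge> - (s * T)" unfolding i by (simp add: mult.commute)
    have "k * T / ?N < sqrt (?m * T / 2) - T"
      using many N by (simp add: divide_less_eq mult.commute)
    then have "s * (k * T / ?N) < s * (sqrt (?m * T / 2) - T)"
      using \<open>s > 0\<close> by (rule mult_strict_left_mono)
    moreover have "2 * sqrt (?m * T / 8) = sqrt (?m * T / 2)"
      using real_sqrt_mult[of 4 "?m * T / 8"] by (simp add: mult.commute)
    then have "2 * s * sqrt (?m * T / 8) = s * sqrt (?m * T / 2)"
      by (metis mult.assoc mult.commute)
    ultimately show ?thesis
      using 1 2 unfolding regret_def right_diff_distrib by linarith
  qed
  with alg show ?thesis by blast
qed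

end

theory Submission
  imports Defs
begin

text \<open>
  Let m = floor (ln k). Since 2^m \<le> k, the m-bit patterns can be assigned to k active experts so that
  each pattern occurs. The rounds are split into m blocks of nearly equal size; in
  block j an active expert loses s times its j-th bit, read as a sign, times a sign \<sigma> t chosen
  by the adversary. If S j is the sum of the signs in block j, the expert whose bits oppose all
  the S j has total loss - s * (\<Sum>j. \<bar>S j\<bar>). With random signs the learner's expected loss is 0;
  derandomised, the adversary picks each sign greedily for the potential (\<Sum>j. E \<bar>S j + W j\<bar>), where
  W j is a simple random walk over the remaining rounds of block j. This is a martingale under fair
  signs, so the regret is at least s times its initial value. Since a walk of n steps has mean
  absolute value at least sqrt (ceiling (n / 2)), this is at least s * sqrt (m * T / 2).
\<close>

section \<open>Mean absolute value of the simple random walk\<close>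

text \<open>This is the mean of \<open>f (x + W)\<close> for a simple random walk \<open>W\<close>
  of \<open>n\<close> steps. Conditioning on the first step avoids probability spaces and matches
  the one sign revealed per round.\<close>

primrec walk_mean :: "(int \<Rightarrow> real) \<Rightarrow> nat \<Rightarrow> int \<Rightarrow> real" where
  "walk_mean f 0 x = f x"
| "walk_mean f (Suc n) x = (walk_mean f n (x + 1) + walk_mean f n (x - 1)) / 2"

text \<open>Tanaka's formula: the mean of \<open>\<bar>x + W\<bar>\<close> grows by the probability of sitting at 0.\<close>

lemma walk_mean_abs_Suc:
  "walk_mean (\<lambda>y. \<bar>real_of_int y\<bar>) (Suc n) x =
   walk_mean (\<lambda>y. \<bar>real_of_int y\<bar>) n x + walk_mean (\<lambda>y. of_bool (y = 0)) n x"
proof (induction n arbitrary: x)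
  case 0
  have "x \<le> -1 \<or> x = 0 \<or> x \<ge> 1" by linarith
  then show ?case by auto
next
  case (Suc n)
  show ?case
    by (subst walk_mean.simps(2), subst Suc.IH, subst Suc.IH) (simp add: field_simps)
qed

lemma walk_mean_zero_far: "\<bar>x\<bar> > int n \<Longrightarrow> walk_mean (\<lambda>y. of_bool (y = 0)) n x = 0"
  by (induction n arbitrary: x) auto

lemma walk_mean_zero_parity: "odd (int n + x) \<Longrightarrow> walk_mean (\<lambda>y. of_bool (y = 0)) n x = 0"
  by (induction n arbitrary: x) auto

text \<open>From this start exactly the paths with \<open>i\<close> down steps end at 0. The
  recursion is Pascal's rule: an up step keeps \<open>i\<close>, a down step lowers it.\<close>

lemma walk_mean_zero_binomial:
  "walk_mean (\<lambda>y. of_bool (y = 0)) n (2 * int i - int n) = real (n choose i) / 2 ^ n"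
proof (induction n arbitrary: i)
  case 0
  then show ?case by (cases i) auto
next
  case (Suc n)
  have up: "2 * int i - int (Suc n) + 1 = 2 * int i - int n" by simp
  show ?case
  proof (cases i)
    case 0
    \<comment> \<open>With no down step allowed, a down step leads out of reach of 0.\<close>
    have "walk_mean (\<lambda>y. of_bool (y = 0)) n (- 2 - int n) = 0"
      by (rule walk_mean_zero_far) simp
    with Suc[of 0] show ?thesis by (simp add: 0)
  next
    case (Suc j)
    have "2 * int i - int (Suc n) - 1 = 2 * int j - int n" by (simp add: Suc)
    then show ?thesis
      by (simp only: walk_mean.simps up Suc.IH) (simp add: Suc field_simps)
  qed
qed

lemma central_binomial_step:
  "real (Suc a) * real (2 * Suc a choose Suc a) = 2 * (2 * real a + 1) * real (2 * a choose a)"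
proof -
  have "Suc a * (2 * Suc a choose Suc a) = 2 * Suc a * (Suc (2 * a) choose a)"
    using Suc_times_binomial[of a "Suc (2 * a)"] by simp
  then have "Suc a * (2 * Suc a choose Suc a) = 2 * (Suc a * (Suc (2 * a) choose Suc a))"
    using binomial_symmetric[of a "Suc (2 * a)"] by simp
  also have "\<dots> = 2 * (Suc (2 * a) * (2 * a choose a))"
    using Suc_times_binomial[of a "2 * a"] by simp
  finally have "real (Suc a * (2 * Suc a choose Suc a)) = real (2 * (Suc (2 * a) * (2 * a choose a)))"
    by (rule arg_cong)
  then show ?thesis by (simp only: of_nat_mult) simp
qed

text \<open>Tanaka's formula taken two steps at a time: parity excludes 0 at odd times, so each pair
  adds only the central binomial probability.\<close>

lemma walk_mean_abs_even:
  "walk_mean (\<lambda>y. \<bar>real_of_int y\<bar>) (2 * a) 0 = 2 * real a * real (2 * a choose a) / 4 ^ a"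
proof (induction a)
  case (Suc a)
  have "walk_mean (\<lambda>y. of_bool (y = 0)) (Suc (2 * a)) 0 = 0"
    by (rule walk_mean_zero_parity) simp
  moreover have "walk_mean (\<lambda>y. of_bool (y = 0)) (2 * a) 0 = real (2 * a choose a) / 4 ^ a"
    using walk_mean_zero_binomial[of "2 * a" a] by (simp add: power_mult)
  moreover have "2 * Suc a = Suc (Suc (2 * a))" by simp
  ultimately have "walk_mean (\<lambda>y. \<bar>real_of_int y\<bar>) (2 * Suc a) 0 =
      (2 * (2 * real a + 1) * real (2 * a choose a)) / (2 * 4 ^ a)"
    using Suc by (simp only: walk_mean_abs_Suc) (simp add: field_simps)
  then show ?case
    by (simp only: central_binomial_step[symmetric]) (simp add: field_simps)
qed simp

lemma walk_mean_abs_odd: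
  "walk_mean (\<lambda>y. \<bar>real_of_int y\<bar>) (Suc (2 * a)) 0 = walk_mean (\<lambda>y. \<bar>real_of_int y\<bar>) (2 * Suc a) 0"
proof -
  have "walk_mean (\<lambda>y. of_bool (y = 0)) (Suc (2 * a)) 0 = 0"
    by (rule walk_mean_zero_parity) simp
  moreover have "2 * Suc a = Suc (Suc (2 * a))" by simp
  ultimately show ?thesis by (simp only: walk_mean_abs_Suc)
qed

text \<open>For \<open>a > 0\<close> the right-hand side grows by the factor
  \<open>(2 * a + 1) / (2 * a)\<close>, whose square is at least \<open>(a + 1) / a\<close>. At 1
  both sides are 1.\<close>

lemma central_binomial_sqrt: "sqrt (real a) \<le> 2 * real a * real (2 * a choose a) / 4 ^ a"
proof (induction a)
  case (Suc a)
  show ?case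
  proof (cases "a = 0")
    case False
    define w where "w = 2 * real a * real (2 * a choose a) / 4 ^ a"
    have "(2 * real a * sqrt (real (Suc a)))\<^sup>2 \<le> ((2 * real a + 1) * sqrt (real a))\<^sup>2"
      by (simp add: power_mult_distrib) (simp add: power2_eq_square algebra_simps)
    then have "2 * real a * sqrt (real (Suc a)) \<le> (2 * real a + 1) * sqrt (real a)"
      by (rule power2_le_imp_le) simp
    also have "\<dots> \<le> (2 * real a + 1) * w"
      using Suc by (intro mult_left_mono) (auto simp: w_def)
    finally have "sqrt (real (Suc a)) \<le> (2 * real a + 1) * w / (2 * real a)"
      using False by (simp add: field_simps)
    also have "\<dots> = 2 * (2 * (2 * real a + 1) * real (2 * a choose a)) / 4 ^ Suc a"
      using False by (simp add: w_def field_simps)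
    also have "\<dots> = 2 * real (Suc a) * real (2 * Suc a choose Suc a) / 4 ^ Suc a"
      using central_binomial_step[of a] by (simp only: mult.assoc)
    finally show ?thesis .
  qed simp
qed simp

text \<open>The rounding up of \<open>n / 2\<close> is possible because an odd walk has the mean of
  the next even one.\<close>

lemma walk_mean_abs_ge_sqrt:
  "sqrt (real (Suc n div 2)) \<le> walk_mean (\<lambda>y. \<bar>real_of_int y\<bar>) n 0"
proof (cases "even n")
  case True
  then obtain a where "n = 2 * a" by blast
  then show ?thesis using central_binomial_sqrt[of a] by (simp add: walk_mean_abs_even)
next
  case False
  then obtain a where "n = 2 * a + 1" by (rule oddE)
  then have n: "n = Suc (2 * a)" by simp
  have "Suc n div 2 = Suc a" by (simp add: n)
  then show ?thesis
    using central_binomial_sqrt[of "Suc a"] unfolding n walk_mean_abs_odd walk_mean_abs_even by simp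
qed

section \<open>Nearly equal blocks of rounds\<close>

text \<open>
  For even q the right-hand side is m times the chord of sqrt between \<open>q / 2\<close> and \<open>q / 2 + 1\<close> at
  \<open>q / 2 + r / m\<close>, which lies below the graph of sqrt, but the comparison is with sqrt at
  \<open>q / 2 + r / (2 * m)\<close>. Only \<open>q = 0\<close> needs the second hypothesis.
\<close>

lemma sqrt_half_chord:
  fixes q r m :: nat
  assumes "r \<le> m" and "m \<le> 2 * (m * q + r)"
  shows "sqrt (real m * real (m * q + r) / 2) \<le>
    real m * sqrt (real (Suc q div 2)) + real r * (sqrt (real (Suc (Suc q) div 2)) - sqrt (real (Suc q div 2)))"
proof (cases "even q")
  case True
  then obtain c where q: "q = 2 * c" by blast
  define x where "x = sqrt (real c)"
  define y where "y = sqrt (real (Suc c))"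
  have x: "x \<ge> 0" "x\<^sup>2 = real c" and y: "y \<ge> 0" "y\<^sup>2 = real c + 1" by (simp_all add: x_def y_def)
  \<comment> \<open>The squares of the two sides of the goal differ by \<open>r / 2\<close> times
    the slack here. For \<open>c = 0\<close> this is the second hypothesis.\<close>
  have key: "real m \<le> 2 * real r + 4 * (real m - real r) * (x * y - real c)"
  proof (cases "c = 0")
    case True
    then show ?thesis using assms by (simp add: q x_def)
  next
    case False
    have "(real c + 1 / 4)\<^sup>2 \<le> (x * y)\<^sup>2"
      using False by (simp add: power_mult_distrib x y) (simp add: power2_eq_square algebra_simps)
    then have "real c + 1 / 4 \<le> x * y"
      by (rule power2_le_imp_le) (simp add: x(1) y(1))
    then have "4 * (real m - real r) * (1 / 4) \<le> 4 * (real m - real r) * (x * y - real c)"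
      using assms by (intro mult_left_mono) auto
    moreover have "4 * (real m - real r) * (1 / 4) = real m - real r" by simp
    ultimately show ?thesis by linarith
  qed
  have "sqrt (real m * real (m * q + r) / 2) \<le> real m * x + real r * (y - x)"
  proof (rule real_le_lsqrt)
    show "0 \<le> real m * x + real r * (y - x)"
    proof -
      have "0 \<le> (real m - real r) * x + real r * y" using assms x y by simp
      then show ?thesis by (simp add: algebra_simps)
    qed
    have "(real m * x + real r * (y - x))\<^sup>2 - real m * real (m * q + r) / 2 =
        (real m - real r)\<^sup>2 * x\<^sup>2 + real r ^ 2 * y\<^sup>2 + 2 * (real m - real r) * real r * (x * y)
        - real m * real (m * q + r) / 2"
      by (simp add: power2_eq_square algebra_simps)
    also have "\<dots> = real r / 2 * (2 * real r + 4 * (real m - real r) * (x * y - real c) - real m)"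
      unfolding x y q by (simp add: power2_eq_square field_simps)
    also have "\<dots> \<ge> 0" using key by (intro mult_nonneg_nonneg) auto
    finally show "real m * real (m * q + r) / 2 \<le> (real m * x + real r * (y - x))\<^sup>2" by simp
  qed
  then show ?thesis by (simp add: q x_def y_def)
next
  case False
  then obtain c where q: "q = 2 * c + 1" by (rule oddE)
  \<comment> \<open>For odd \<open>q\<close> both roots on the right are
    \<open>sqrt (c + 1)\<close>, so the slope vanishes.\<close>
  have "sqrt (real m * real (m * q + r) / 2) \<le> sqrt ((real m)\<^sup>2 * real (Suc c))"
  proof (rule real_sqrt_le_mono)
    have "real m * real (m * q + r) \<le> real m * real (m * q + m)"
      using assms by (intro mult_left_mono) auto
    then show "real m * real (m * q + r) / 2 \<le> (real m)\<^sup>2 * real (Suc c)"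
      by (simp add: q power2_eq_square algebra_simps)
  qed
  then show ?thesis by (simp add: q real_sqrt_mult)
qed

text \<open>The class consists of rounds \<open>Suc (i * m + j)\<close>: every
  \<open>i < T div m\<close> fits, no \<open>i > T div m\<close> does.\<close>

lemma card_residue_class:
  fixes m T j :: nat
  assumes "j < m"
  shows "card {t\<in>{1..T}. (t - 1) mod m = j} \<in> {T div m, Suc (T div m)}"
proof -
  let ?q = "T div m"
  have up: "{t\<in>{1..T}. (t - 1) mod m = j} \<subseteq> (\<lambda>i. Suc (i * m + j)) ` {..?q}"
  proof
    fix t assume t: "t \<in> {t\<in>{1..T}. (t - 1) mod m = j}"
    then have "t = Suc ((t - 1) div m * m + j)"
      using div_mult_mod_eq[of "t - 1" m] by auto
    moreover have "(t - 1) div m \<le> ?q" using t by (intro div_le_mono) auto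
    ultimately show "t \<in> (\<lambda>i. Suc (i * m + j)) ` {..?q}" by blast
  qed
  have low: "(\<lambda>i. Suc (i * m + j)) ` {..<?q} \<subseteq> {t\<in>{1..T}. (t - 1) mod m = j}"
  proof
    fix t assume "t \<in> (\<lambda>i. Suc (i * m + j)) ` {..<?q}"
    then obtain i where i: "i < ?q" "t = Suc (i * m + j)" by blast
    have "Suc i * m \<le> ?q * m" using i by (intro mult_right_mono) auto
    also have "\<dots> \<le> T" by simp
    finally have "Suc i * m \<le> T" .
    then show "t \<in> {t\<in>{1..T}. (t - 1) mod m = j}" using assms i by simp
  qed
  have inj: "inj (\<lambda>i. Suc (i * m + j))" using assms by (auto simp: inj_def)
  have "?q \<le> card {t\<in>{1..T}. (t - 1) mod m = j}"
    using card_mono[OF _ low] inj by (simp add: card_image inj_on_subset)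
  moreover have "card {t\<in>{1..T}. (t - 1) mod m = j} \<le> Suc ?q"
    using card_mono[OF _ up] inj by (simp add: card_image inj_on_subset)
  ultimately show ?thesis by auto
qed

lemma sum_walk_mean_blocks:
  fixes m T :: nat
  assumes "m > 0" and "m \<le> 2 * T"
  shows "sqrt (real m * real T / 2) \<le>
    (\<Sum>j<m. walk_mean (\<lambda>y. \<bar>real_of_int y\<bar>) (card {t\<in>{1..T}. (t - 1) mod m = j}) 0)"
proof -
  define q where "q = T div m"
  define r where "r = T mod m"
  define n where "n j = card {t\<in>{1..T}. (t - 1) mod m = j}" for j
  define g where "g a = sqrt (real (Suc a div 2))" for a
  have T: "T = m * q + r" by (simp add: q_def r_def)
  have r: "r \<le> m" using assms by (simp add: r_def less_imp_le)
  have n: "n j \<in> {q, Suc q}" if "j < m" for j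
    using card_residue_class[OF that] by (simp add: n_def q_def)
  have "(\<Sum>j<m. n j) = card (\<Union>j<m. {t\<in>{1..T}. (t - 1) mod m = j})"
    unfolding n_def by (rule card_UN_disjoint[symmetric]) auto
  also have "(\<Union>j<m. {t\<in>{1..T}. (t - 1) mod m = j}) = {1..T}"
    using assms by auto
  finally have sum_n: "(\<Sum>j<m. real (n j)) = real T" by (simp flip: of_nat_sum)
  have "sqrt (real m * real T / 2) \<le> real m * g q + real r * (g (Suc q) - g q)"
    using sqrt_half_chord[of r m q] assms r unfolding T[symmetric] g_def by simp
  \<comment> \<open>On \<open>q\<close> and \<open>Suc q\<close> the function \<open>g\<close>
    agrees with its chord, so the total of the block sizes suffices.\<close>
  also have "\<dots> = (\<Sum>j<m. g q + (real (n j) - real q) * (g (Suc q) - g q))"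
    by (simp add: sum.distrib sum_subtractf sum_n T flip: sum_distrib_right)
  also have "\<dots> = (\<Sum>j<m. g (n j))"
  proof (rule sum.cong)
    fix j assume "j \<in> {..<m}"
    then have "n j = q \<or> n j = Suc q" using n[of j] by simp
    then show "g q + (real (n j) - real q) * (g (Suc q) - g q) = g (n j)" by auto
  qed simp
  also have "\<dots> \<le> (\<Sum>j<m. walk_mean (\<lambda>y. \<bar>real_of_int y\<bar>) (n j) 0)"
    unfolding g_def by (intro sum_mono walk_mean_abs_ge_sqrt)
  finally show ?thesis by (simp add: n_def)
qed

section \<open>The derandomised adversary\<close>

text \<open>The learner's term \<open>d\<close> cancels between the two signs, so one of them keeps
  potential plus loss from dropping. Causality includes \<open>t = u\<close>: the play precedes the
  sign of its own round.\<close>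

lemma greedy_signs:
  fixes \<Phi> :: "nat \<Rightarrow> (nat \<Rightarrow> int) \<Rightarrow> real" and d :: "(nat \<Rightarrow> int) \<Rightarrow> nat \<Rightarrow> real"
  assumes causal: "\<And>\<sigma> t u x. t \<le> u \<Longrightarrow> d (\<sigma>(u := x)) t = d \<sigma> t"
    and step: "\<And>\<sigma> n. n < T \<Longrightarrow>
      \<Phi> n \<sigma> \<le> (\<Phi> (Suc n) (\<sigma>(Suc n := 1)) + \<Phi> (Suc n) (\<sigma>(Suc n := -1))) / 2"
  shows "\<exists>\<sigma>. (\<forall>t. \<sigma> t \<in> {1, -1}) \<and> \<Phi> 0 (\<lambda>_. 1) \<le> \<Phi> T \<sigma> + (\<Sum>t = 1..T. \<sigma> t * d \<sigma> t)"
proof -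
  have "\<exists>\<sigma>. (\<forall>t. \<sigma> t \<in> {1, -1}) \<and> \<Phi> 0 (\<lambda>_. 1) \<le> \<Phi> n \<sigma> + (\<Sum>t = 1..n. \<sigma> t * d \<sigma> t)"
    if "n \<le> T" for n
    using that
  proof (induction n)
    case 0
    show ?case by (intro exI[of _ "\<lambda>_. 1"]) simp
  next
    case (Suc n)
    then obtain \<sigma> where \<sigma>: "\<forall>t. \<sigma> t \<in> {1, -1}"
      and le: "\<Phi> 0 (\<lambda>_. 1) \<le> \<Phi> n \<sigma> + (\<Sum>t = 1..n. \<sigma> t * d \<sigma> t)" by auto
    have upd: "(\<Sum>t = 1..Suc n. (\<sigma>(Suc n := x)) t * d (\<sigma>(Suc n := x)) t) =
        (\<Sum>t = 1..n. \<sigma> t * d \<sigma> t) + x * d \<sigma> (Suc n)" for x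
      by (simp add: causal)
    have "\<Phi> n \<sigma> \<le> \<Phi> (Suc n) (\<sigma>(Suc n := 1)) + d \<sigma> (Suc n) \<or>
        \<Phi> n \<sigma> \<le> \<Phi> (Suc n) (\<sigma>(Suc n := -1)) - d \<sigma> (Suc n)"
    proof -
      have "p \<le> (x + y) / 2 \<Longrightarrow> p \<le> x + e \<or> p \<le> y - e" for p x y e :: real
        by argo
      then show ?thesis using step[OF Suc_le_lessD[OF Suc.prems], of \<sigma>] by blast
    qed
    then obtain x :: int where x: "x \<in> {1, -1}"
      and "\<Phi> n \<sigma> \<le> \<Phi> (Suc n) (\<sigma>(Suc n := x)) + x * d \<sigma> (Suc n)"
      by force
    with le have "\<Phi> 0 (\<lambda>_. 1) \<le> \<Phi> (Suc n) (\<sigma>(Suc n := x)) +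
        (\<Sum>t = 1..Suc n. (\<sigma>(Suc n := x)) t * d (\<sigma>(Suc n := x)) t)"
      unfolding upd by linarith
    moreover have "\<forall>t. (\<sigma>(Suc n := x)) t \<in> {1, -1}" using \<sigma> x by simp
    ultimately show ?case by blast
  qed
  then show ?thesis by blast
qed

text \<open>Round \<open>Suc n\<close> moves from the remaining rounds of its block to its partial
  sum, which is one unfolding of \<open>walk_mean\<close>; other blocks stay the same.\<close>

lemma block_potential_step:
  fixes f :: "int \<Rightarrow> real" and b :: "nat \<Rightarrow> nat" and T m :: nat
  defines "\<Phi> \<equiv> \<lambda>n \<sigma>. \<Sum>j<m. walk_mean f (card {t\<in>{n<..T}. b t = j}) (\<Sum>t | t \<in> {1..n} \<and> b t = j. \<sigma> t)"
  assumes "n < T" and b: "b (Suc n) < m"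
  shows "\<Phi> n \<sigma> = (\<Phi> (Suc n) (\<sigma>(Suc n := 1)) + \<Phi> (Suc n) (\<sigma>(Suc n := -1))) / 2"
proof -
  have eq: "walk_mean f (card {t\<in>{n<..T}. b t = j}) (\<Sum>t | t \<in> {1..n} \<and> b t = j. \<sigma> t) =
      (walk_mean f (card {t\<in>{Suc n<..T}. b t = j}) (\<Sum>t | t \<in> {1..Suc n} \<and> b t = j. (\<sigma>(Suc n := 1)) t) +
       walk_mean f (card {t\<in>{Suc n<..T}. b t = j}) (\<Sum>t | t \<in> {1..Suc n} \<and> b t = j. (\<sigma>(Suc n := -1)) t)) / 2"
    for j
  proof (cases "b (Suc n) = j")
    case True
    have "{t\<in>{n<..T}. b t = j} = insert (Suc n) {t\<in>{Suc n<..T}. b t = j}"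
      using True assms by (auto simp: Suc_lessI)
    then have card: "card {t\<in>{n<..T}. b t = j} = Suc (card {t\<in>{Suc n<..T}. b t = j})" by simp
    have "{t. t \<in> {1..Suc n} \<and> b t = j} = insert (Suc n) {t. t \<in> {1..n} \<and> b t = j}"
      using True by (auto simp: le_Suc_eq)
    then have "(\<Sum>t | t \<in> {1..Suc n} \<and> b t = j. (\<sigma>(Suc n := x)) t) =
        (\<Sum>t | t \<in> {1..n} \<and> b t = j. \<sigma> t) + x" for x
      by (simp add: add.commute)
    then show ?thesis unfolding card by simp
  next
    case False
    have 1: "{t\<in>{n<..T}. b t = j} = {t\<in>{Suc n<..T}. b t = j}"
      using False by (auto simp: Suc_lessI) (metis Suc_lessI)
    have "{t. t \<in> {1..Suc n} \<and> b t = j} = {t. t \<in> {1..n} \<and> b t = j}"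
      using False by (auto simp: le_Suc_eq)
    then have "(\<Sum>t | t \<in> {1..Suc n} \<and> b t = j. (\<sigma>(Suc n := x)) t) =
        (\<Sum>t | t \<in> {1..n} \<and> b t = j. \<sigma> t)" for x
      by (auto intro!: sum.cong)
    then show ?thesis unfolding 1 by simp
  qed
  show ?thesis
    unfolding \<Phi>_def sum.distrib[symmetric] sum_divide_distrib by (intro sum.cong refl eq)
qed

section \<open>Regret lower bounds\<close>

text \<open>Covers \<open>floor (ln k) = 0\<close>, where there are no blocks.\<close>

lemma zero_regret_const:
  fixes A :: "(real^'n) list \<Rightarrow> real^'n"
  assumes A: "online_algorithm T A" and "s \<ge> 0" and "K \<noteq> {}"
  shows "regret A (\<lambda>_. \<chi> i. if i \<in> K then - s else 0) T \<ge> 0"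
proof -
  let ?l = "\<lambda>_::nat. (\<chi> i. if i \<in> K then - s else 0) :: real^'n"
  have "- s \<le> play A ?l t \<bullet> ?l t" if "t \<in> {1..T}" for t
  proof -
    have p: "play A ?l t \<in> prob_simplex"
      using A that by (auto simp: online_algorithm_def play_def)
    have "- s = (\<Sum>i\<in>UNIV. play A ?l t $ i * - s)"
      using p unfolding sum_distrib_right[symmetric] by (simp add: prob_simplex_def)
    also have "\<dots> \<le> (\<Sum>i\<in>UNIV. play A ?l t $ i * ?l t $ i)"
      using p \<open>s \<ge> 0\<close> by (intro sum_mono mult_left_mono) (auto simp: prob_simplex_def)
    finally show ?thesis by (simp add: inner_vec_def)
  qed
  then have "(\<Sum>t = 1..T. - s) \<le> (\<Sum>t = 1..T. play A ?l t \<bullet> ?l t)" by (rule sum_mono)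
  moreover obtain i where "i \<in> K" using assms by blast
  then have "Min (range (\<lambda>i. \<Sum>t = 1..T. ?l t $ i)) \<le> (\<Sum>t = 1..T. - s)"
    by (intro Min_le) (auto intro!: image_eqI[of _ _ i])
  ultimately show ?thesis unfolding regret_def by linarith
qed

lemma ex_map_onto_Pow:
  assumes "finite K" and "2 ^ m \<le> card K"
  shows "\<exists>B :: 'a \<Rightarrow> nat set. B ` K = Pow {..<m}"
proof -
  have "card (Pow {..<m}) \<le> card K" using assms by (simp add: card_Pow)
  then obtain f :: "nat set \<Rightarrow> 'a" where f: "f ` Pow {..<m} \<subseteq> K" "inj_on f (Pow {..<m})"
    using card_le_inj[of "Pow {..<m}" K] assms by auto
  \<comment> \<open>Elements outside the image of \<open>f\<close> get the empty pattern, which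
    keeps the map inside \<open>Pow {..<m}\<close>.\<close>
  have "(\<lambda>i. if i \<in> f ` Pow {..<m} then inv_into (Pow {..<m}) f i else {}) ` K = Pow {..<m}"
    (is "?B ` K = _")
  proof
    show "?B ` K \<subseteq> Pow {..<m}" using f by auto
    show "Pow {..<m} \<subseteq> ?B ` K"
    proof
      fix X assume X: "X \<in> Pow {..<m}"
      then have "?B (f X) = X" using f by (simp add: inv_into_f_f)
      moreover have "f X \<in> K" using f X by blast
      ultimately show "X \<in> ?B ` K" by (intro rev_image_eqI[of "f X"]) simp_all
    qed
  qed
  then show ?thesis by blast
qed

lemma regret_ge_blocks:
  fixes A :: "(real^'n) list \<Rightarrow> real^'n" and K :: "'n set" and m T :: nat and s :: real
  assumes "2 ^ m \<le> card K" and b: "\<And>t. b t < m"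
  shows "\<exists>l :: nat \<Rightarrow> real^'n.
    (\<forall>t i. l t $ i \<in> (if i \<in> K then {s, - s} else {0})) \<and>
    s * (\<Sum>j<m. walk_mean (\<lambda>y. \<bar>real_of_int y\<bar>) (card {t\<in>{1..T}. b t = j}) 0) \<le> regret A l T"
proof -
  obtain B :: "'n \<Rightarrow> nat set" where B: "B ` K = Pow {..<m}"
    using ex_map_onto_Pow[of K m] assms by auto
  define v :: "nat \<Rightarrow> real^'n" where
    "v t = (\<chi> i. if i \<in> K then (if b t \<in> B i then s else - s) else 0)" for t
  define l where "l \<sigma> t = real_of_int (\<sigma> t) *\<^sub>R v t" for \<sigma> t
  define d where "d \<sigma> t = play A (l \<sigma>) t \<bullet> v t" for \<sigma> t
  define \<Phi> where "\<Phi> n \<sigma> = s * (\<Sum>j<m. walk_mean (\<lambda>y. \<bar>real_of_int y\<bar>)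
    (card {t\<in>{n<..T}. b t = j}) (\<Sum>t | t \<in> {1..n} \<and> b t = j. \<sigma> t))" for n \<sigma>
  have "\<exists>\<sigma>. (\<forall>t. \<sigma> t \<in> {1, -1}) \<and> \<Phi> 0 (\<lambda>_. 1) \<le> \<Phi> T \<sigma> + (\<Sum>t = 1..T. \<sigma> t * d \<sigma> t)"
  proof (rule greedy_signs)
    show "d (\<sigma>(u := x)) t = d \<sigma> t" if "t \<le> u" for \<sigma> t u x
    proof -
      have "map (l (\<sigma>(u := x))) [1..<t] = map (l \<sigma>) [1..<t]" using that by (simp add: l_def)
      then show ?thesis by (simp only: d_def play_def)
    qed
    show "\<Phi> n \<sigma> \<le> (\<Phi> (Suc n) (\<sigma>(Suc n := 1)) + \<Phi> (Suc n) (\<sigma>(Suc n := -1))) / 2"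
      if "n < T" for n \<sigma>
      unfolding \<Phi>_def block_potential_step[OF that b] by (simp add: field_simps)
  qed
  then obtain \<sigma> where \<sigma>: "\<forall>t. \<sigma> t \<in> {1, -1}"
    and le: "\<Phi> 0 (\<lambda>_. 1) \<le> \<Phi> T \<sigma> + (\<Sum>t = 1..T. \<sigma> t * d \<sigma> t)" by blast
  define S where "S j = (\<Sum>t | t \<in> {1..T} \<and> b t = j. \<sigma> t)" for j
  \<comment> \<open>The best expert has its bit set exactly where \<open>S j\<close> is negative, so
    block \<open>j\<close> contributes \<open>- (s * \<bar>S j\<bar>)\<close>.\<close>
  have "{j. j < m \<and> S j < 0} \<in> Pow {..<m}" by auto
  then obtain i where i: "{j. j < m \<and> S j < 0} = B i" "i \<in> K"
    unfolding B[symmetric] by (rule imageE)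
  have "(\<Sum>t = 1..T. l \<sigma> t $ i) =
      (\<Sum>j<m. \<Sum>t | t \<in> {1..T} \<and> b t = j. l \<sigma> t $ i)"
    by (rule sum.group[symmetric]) (use b in auto)
  also have "\<dots> = (\<Sum>j<m. - (s * \<bar>real_of_int (S j)\<bar>))"
  proof (rule sum.cong)
    fix j assume j: "j \<in> {..<m}"
    have "(\<Sum>t | t \<in> {1..T} \<and> b t = j. l \<sigma> t $ i) =
        (\<Sum>t | t \<in> {1..T} \<and> b t = j. real_of_int (\<sigma> t) * (if S j < 0 then s else - s))"
      using i(2) j by (intro sum.cong) (auto simp: l_def v_def simp flip: i(1))
    also have "\<dots> = real_of_int (S j) * (if S j < 0 then s else - s)"
      by (simp only: S_def of_int_sum sum_distrib_right)
    finally show "(\<Sum>t | t \<in> {1..T} \<and> b t = j. l \<sigma> t $ i) = - (s * \<bar>real_of_int (S j)\<bar>)" by simp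
  qed simp
  \<comment> \<open>At time \<open>T\<close> no rounds remain, so each walk mean is just
    \<open>\<bar>S j\<bar>\<close>.\<close>
  also have "\<dots> = - \<Phi> T \<sigma>"
    by (simp add: \<Phi>_def S_def sum_negf sum_distrib_left)
  finally have "(\<Sum>t = 1..T. l \<sigma> t $ i) = - \<Phi> T \<sigma>" .
  moreover have "Min (range (\<lambda>i. \<Sum>t = 1..T. l \<sigma> t $ i)) \<le> (\<Sum>t = 1..T. l \<sigma> t $ i)"
    by (intro Min_le) auto
  moreover have "(\<Sum>t = 1..T. play A (l \<sigma>) t \<bullet> l \<sigma> t) = (\<Sum>t = 1..T. \<sigma> t * d \<sigma> t)"
    by (simp add: l_def d_def)
  \<comment> \<open>At time 0 all partial sums are empty, so the walks start at 0 with whole blocks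
    ahead.\<close>
  moreover have "{0<..T} = {1..T}" by auto
  ultimately have "s * (\<Sum>j<m. walk_mean (\<lambda>y. \<bar>real_of_int y\<bar>) (card {t\<in>{1..T}. b t = j}) 0)
      \<le> regret A (l \<sigma>) T"
    using le unfolding regret_def by (simp add: \<Phi>_def)
  moreover have "l \<sigma> t $ i \<in> (if i \<in> K then {s, - s} else {0})" for t i
    using \<sigma>[rule_format, of t] by (auto simp: l_def v_def)
  ultimately show ?thesis by blast
qed

theorem corollary15:
  fixes A :: "(real^'n) list \<Rightarrow> real^'n" and s :: real and k T :: nat
  assumes "k \<in> {1..CARD('n)}" and "s > 0"
    and "online_algorithm T A"
    and horizon: "\<lfloor>ln (real k)\<rfloor> \<le> 2 * int T"
  shows "\<exists>l :: nat \<Rightarrow> real^'n.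
    (\<forall>t\<in>{1..T}. (\<forall>i. l t $ i \<in> {-s..s}) \<and> zero_norm (l t) = k) \<and>
    regret A l T \<ge> 2 * s * sqrt (of_int \<lfloor>ln (real k)\<rfloor> * real T / 8)"
proof -
  obtain K :: "'n set" where K: "card K = k"
    using assms(1) obtain_subset_with_card_n[of k "UNIV :: 'n set"] by auto
  define m where "m = nat \<lfloor>ln (real k)\<rfloor>"
  have m: "\<lfloor>ln (real k)\<rfloor> = int m" using assms(1) by (simp add: m_def)
  have "\<exists>l :: nat \<Rightarrow> real^'n. (\<forall>t i. l t $ i \<in> (if i \<in> K then {s, - s} else {0})) \<and>
      s * sqrt (real m * real T / 2) \<le> regret A l T"
  proof (cases "m = 0")
    case True
    have "K \<noteq> {}" using K assms(1) by auto
    then have "s * sqrt (real m * real T / 2) \<le> regret A (\<lambda>_. \<chi> i. if i \<in> K then - s else 0) T"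
      using zero_regret_const[OF assms(3)] assms(2) True by simp
    then show ?thesis by (intro exI) (auto simp del: real_sqrt_mult)
  next
    case False
    \<comment> \<open>\<open>2 ^ m \<le> exp m \<le> k\<close> provides enough active experts for
      all patterns.\<close>
    have "real m \<le> ln (real k)" using m by linarith
    then have "exp (real m) \<le> real k"
      using assms(1) by (simp add: ln_ge_iff)
    moreover have "(2::real) ^ m \<le> exp 1 ^ m"
      using exp_ge_add_one_self[of "1::real"] by (intro power_mono) auto
    then have "(2::real) ^ m \<le> exp (real m)" by (simp flip: exp_of_nat_mult)
    ultimately have "(2::real) ^ m \<le> real k" by linarith
    then have "2 ^ m \<le> card K" by (simp add: K)
    \<comment> \<open>Blocks are residue classes, so their sizes differ by at most one.\<close>
    moreover have "(t - 1) mod m < m" for t using False by simp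
    ultimately obtain l :: "nat \<Rightarrow> real^'n"
      where l: "\<forall>t i. l t $ i \<in> (if i \<in> K then {s, - s} else {0})"
        and R: "s * (\<Sum>j<m. walk_mean (\<lambda>y. \<bar>real_of_int y\<bar>) (card {t\<in>{1..T}. (t - 1) mod m = j}) 0)
          \<le> regret A l T"
      using regret_ge_blocks[of m K "\<lambda>t. (t - 1) mod m" s T A] by blast
    have "m \<le> 2 * T" using horizon m by linarith
    with False have "s * sqrt (real m * real T / 2) \<le>
        s * (\<Sum>j<m. walk_mean (\<lambda>y. \<bar>real_of_int y\<bar>) (card {t\<in>{1..T}. (t - 1) mod m = j}) 0)"
      using assms(2) by (intro mult_left_mono sum_walk_mean_blocks) auto
    with l R show ?thesis by (meson order_trans)
  qed
  then obtain l :: "nat \<Rightarrow> real^'n"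
    where l: "\<And>t i. l t $ i \<in> (if i \<in> K then {s, - s} else {0})"
      and R: "s * sqrt (real m * real T / 2) \<le> regret A l T" by blast
  have range: "l t $ i \<in> {-s..s}" for t i using l[of t i] assms(2) by (auto split: if_splits)
  have "l t $ i \<noteq> 0 \<longleftrightarrow> i \<in> K" for t i
    using l[of t i] assms(2) by (auto split: if_splits)
  then have zero_norm: "zero_norm (l t) = k" for t by (simp add: zero_norm_def K)
  have "2 * sqrt (real m * real T / 8) = sqrt (real m * real T / 2)"
    using real_sqrt_mult[of 4 "real m * real T / 8"] by (simp add: mult.commute)
  then have "2 * s * sqrt (real m * real T / 8) = s * sqrt (real m * real T / 2)"
    by (metis mult.assoc mult.commute)
  with R have "2 * s * sqrt (of_int \<lfloor>ln (real k)\<rfloor> * real T / 8) \<le> regret A l T"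
    by (simp only: m of_int_of_nat_eq)
  with range zero_norm show ?thesis by blast
qed

end
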